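(* Let $(X_t)_{t\ge 1}$ be random vectors in $\mathbb{R}^d$ with constant conditional mean $\mathbb{E}[X_t\mid\mathcal{F}_{t-1}]=\mu$ for all $t\ge 1$, and suppose $(X_t)$ is conditionally $(\Sigma_t)$-sub-Gaussian. Let $(\lambda_t)_{t\ge1}$ be a predictable sequence in $(0,\infty)$, fix $\beta>0$ and $\alpha\in(0,1)$. Then, with probability at least $1-\alpha$, simultaneously for all $t\geq 1$, $$\left\|\frac{\sum_{i\leq t} \lambda_i X_i}{\sum_{i\leq t}\lambda_i} - \mu\right\| \leq \frac{\sum_{i\leq t}\psi_N(\lambda_i)\big(\|\Sigma_i\| + \beta^{-1}\mathrm{Tr}(\Sigma_i)\big) + \beta/2 + \log(1/\alpha)}{\sum_{i\leq t}\lambda_i}.$$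
   Context: $\mathcal{F}_t=\sigma(X_1,\dots,X_t)$ is the $\sigma$-field generated by the first $t$ observations ($\mathcal{F}_0$ trivial); a sequence $(\lambda_t)$ is predictable if $\lambda_t$ is $\mathcal{F}_{t-1}$-measurable for every $t$. $\|\cdot\|$ is the Euclidean norm for vectors and the operator norm for matrices. $\psi_N(\lambda)=\lambda^2/2$. The sequence $(X_t)$ is conditionally $(\Sigma_t)$-sub-Gaussian if, for every $t$, $\Sigma_t$ is an $\mathcal{F}_t$-measurable (not necessarily predictable) random positive semidefinite $d\times d$ matrix and $$\mathbb{E}\big[\exp\{\lambda\langle\theta,X_t-\mu\rangle-\psi_N(\lambda)\langle\theta,\Sigma_t\theta\rangle\}\mid\mathcal{F}_{t-1}\big]\le 1\quad\text{for all }\theta\in\mathbb{R}^d,\ \lambda\in\mathbb{R}.$$ *)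

theory Defs
  imports "HOL-Probability.Probability"
begin

text \<open>Processes are indexed by natural numbers, but time starts at 1: the value of a process at
  index 0 is never used. For \<open>t = 0\<close> the generating family below is empty, so that \<open>\<F>\<^sub>0\<close> is the
  trivial sigma-algebra.\<close>

definition obs_filtration ::
  "'a measure \<Rightarrow> (nat \<Rightarrow> 'a \<Rightarrow> 'b::topological_space) \<Rightarrow> nat \<Rightarrow> 'a measure" where
  "obs_filtration M X t =
     sigma (space M) (\<Union>i\<in>{1..t}. {X i -` A \<inter> space M | A. A \<in> sets borel})"

definition predictable ::
  "(nat \<Rightarrow> 'a measure) \<Rightarrow> (nat \<Rightarrow> 'a \<Rightarrow> 'b::topological_space) \<Rightarrow> bool" where
  "predictable F l \<longleftrightarrow> (\<forall>t\<ge>1. l t \<in> borel_measurable (F (t - 1)))"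

text \<open>The library's conditional expectation is real-valued; for vectors it is taken coordinatewise.
  It is meaningful only for integrable arguments.\<close>

definition vec_cond_exp ::
  "'a measure \<Rightarrow> 'a measure \<Rightarrow> ('a \<Rightarrow> real ^ 'n) \<Rightarrow> 'a \<Rightarrow> real ^ 'n" where
  "vec_cond_exp M F Y = (\<lambda>\<omega>. \<chi> k. real_cond_exp M F (\<lambda>\<omega>'. Y \<omega>' $ k) \<omega>)"

definition const_cond_mean ::
  "'a measure \<Rightarrow> (nat \<Rightarrow> 'a \<Rightarrow> real ^ 'n) \<Rightarrow> real ^ 'n \<Rightarrow> bool" where
  "const_cond_mean M X \<mu> \<longleftrightarrow>
     (\<forall>t\<ge>1. integrable M (X t) \<and>
        (AE \<omega> in M. vec_cond_exp M (obs_filtration M X (t - 1)) (X t) \<omega> = \<mu>))"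

definition pos_semidef :: "real ^ 'n ^ 'n \<Rightarrow> bool" where
  "pos_semidef A \<longleftrightarrow> transpose A = A \<and> (\<forall>v. 0 \<le> v \<bullet> (A *v v))"

text \<open>The library's \<open>norm\<close> on \<^typ>\<open>real ^ 'n ^ 'n\<close> is the Frobenius norm, not the operator norm.\<close>

definition op_norm :: "real ^ 'n ^ 'n \<Rightarrow> real" where
  "op_norm A = onorm (\<lambda>v. A *v v)"

definition psi_N :: "real \<Rightarrow> real" where
  "psi_N l = l\<^sup>2 / 2"

text \<open>The conditional expectation of the nonnegative exponential is taken in \<^typ>\<open>ennreal\<close>, so no
  integrability has to be assumed. The exceptional null set may depend on \<open>\<theta>\<close> and \<open>l\<close>.\<close>

definition cond_sub_gaussian ::
  "'a measure \<Rightarrow> (nat \<Rightarrow> 'a \<Rightarrow> real ^ 'n) \<Rightarrow> real ^ 'n \<Rightarrow> (nat \<Rightarrow> 'a \<Rightarrow> real ^ 'n ^ 'n) \<Rightarrow> bool" where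
  "cond_sub_gaussian M X \<mu> \<Sigma> \<longleftrightarrow>
     (\<forall>t\<ge>1.
        \<Sigma> t \<in> borel_measurable (obs_filtration M X t) \<and>
        (\<forall>\<omega>\<in>space M. pos_semidef (\<Sigma> t \<omega>)) \<and>
        (\<forall>\<theta> l. AE \<omega> in M.
           nn_cond_exp M (obs_filtration M X (t - 1))
             (\<lambda>\<omega>'. ennreal (exp (l * (\<theta> \<bullet> (X t \<omega>' - \<mu>)) - psi_N l * (\<theta> \<bullet> (\<Sigma> t \<omega>' *v \<theta>))))) \<omega>
           \<le> 1))"

end

theory Submission
  imports Defs
begin

text \<open>For fixed \<open>\<theta>\<close> the exponentials of \<open>\<Sum>i\<le>t. \<lambda>\<^sub>i \<langle>\<theta>, X\<^sub>i - \<mu>\<rangle> - \<psi>(\<lambda>\<^sub>i) \<langle>\<theta>, \<Sigma>\<^sub>i \<theta>\<rangle>\<close> form a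
  nonnegative supermartingale started at 1, and so does their mixture over \<open>\<theta> \<sim> N(0, \<beta>\<^sup>-\<^sup>1 I)\<close>; by
  Ville's inequality the mixture stays below \<open>1/\<alpha>\<close> forever with probability at least \<open>1 - \<alpha>\<close>. On
  that event a PAC-Bayes argument with posterior \<open>N(\<nu>, \<beta>\<^sup>-\<^sup>1 I)\<close>, where \<open>\<nu>\<close> is the unit vector in the
  direction of \<open>\<Sum>i\<le>t. \<lambda>\<^sub>i (X\<^sub>i - \<mu>)\<close>, bounds the norm of that sum: the posterior mean of
  \<open>\<langle>\<theta>, \<Sigma>\<^sub>i \<theta>\<rangle>\<close> is \<open>\<langle>\<nu>, \<Sigma>\<^sub>i \<nu>\<rangle> + \<beta>\<^sup>-\<^sup>1 Tr \<Sigma>\<^sub>i\<close>, and the divergence from the prior is \<open>\<beta>/2\<close>.\<close>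


subsection \<open>The filtration and supermartingales\<close>

lemma space_obs_filtration [simp]: "space (obs_filtration M X t) = space M"
  by (simp add: obs_filtration_def space_measure_of_conv)

lemma sets_obs_filtration:
  "sets (obs_filtration M X t) =
     sigma_sets (space M) (\<Union>i\<in>{1..t}. {X i -` A \<inter> space M | A. A \<in> sets borel})"
  unfolding obs_filtration_def by (rule sets_measure_of) auto

lemma measurable_obs_filtration:
  assumes "1 \<le> i" "i \<le> t"
  shows "X i \<in> borel_measurable (obs_filtration M X t)"
proof (rule measurableI)
  fix A :: "'b set" assume "A \<in> sets borel"
  with assms show "X i -` A \<inter> space (obs_filtration M X t) \<in> sets (obs_filtration M X t)"
    unfolding sets_obs_filtration space_obs_filtration by (intro sigma_sets.Basic) force
qed simp

lemma subalgebra_obs_filtration: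
  assumes "\<And>i. 1 \<le> i \<Longrightarrow> X i \<in> borel_measurable M"
  shows "subalgebra M (obs_filtration M X t)"
  unfolding subalgebra_def sets_obs_filtration
  using assms by (auto intro!: sets.sigma_sets_subset measurable_sets)

lemma subalgebra_obs_filtration_mono:
  assumes "s \<le> t"
  shows "subalgebra (obs_filtration M X t) (obs_filtration M X s)"
  unfolding subalgebra_def sets_obs_filtration space_obs_filtration
  using assms by (intro conjI refl sigma_sets_mono' UN_mono) auto

text \<open>Ville's inequality. The induction carries the mass of the supermartingale on the event that
  the level has not yet been reached, which takes the place of optional stopping.\<close>

lemma Ville_inequality:
  fixes V :: "nat \<Rightarrow> 'a \<Rightarrow> ennreal"
  assumes sub: "\<And>t. subalgebra M (F t)"
    and mono: "\<And>s t. s \<le> t \<Longrightarrow> subalgebra (F t) (F s)"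
    and adapted: "\<And>t. V t \<in> borel_measurable (F t)"
    and super: "\<And>t B. B \<in> sets (F t) \<Longrightarrow>
      (\<integral>\<^sup>+\<omega>. V (Suc t) \<omega> * indicator B \<omega> \<partial>M) \<le> (\<integral>\<^sup>+\<omega>. V t \<omega> * indicator B \<omega> \<partial>M)"
  shows "c * emeasure M {\<omega> \<in> space M. \<exists>t. c \<le> V t \<omega>} \<le> (\<integral>\<^sup>+\<omega>. V 0 \<omega> \<partial>M)"
proof -
  define A where "A T = {\<omega> \<in> space M. \<exists>t\<le>T. c \<le> V t \<omega>}" for T :: nat
  have meas: "V s \<in> borel_measurable (F t)" if "s \<le> t" for s t
    using measurable_from_subalg[OF mono[OF that] adapted] .
  have [measurable]: "V t \<in> borel_measurable M" for t
    using measurable_from_subalg[OF sub adapted] .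
  have sp: "space (F t) = space M" for t using sub[of t] by (simp add: subalgebra_def)
  have A_F: "A T \<in> sets (F T)" for T
  proof -
    have "A T = (\<Union>t\<in>{..T}. {\<omega> \<in> space (F T). c \<le> V t \<omega>})"
      by (auto simp: A_def sp)
    moreover have "{\<omega> \<in> space (F T). c \<le> V t \<omega>} \<in> sets (F T)" if "t \<le> T" for t
      using meas[OF that] by measurable
    ultimately show ?thesis by auto
  qed
  have [measurable]: "A T \<in> sets M" for T
    using A_F[of T] sub[of T] by (auto simp: subalgebra_def)
  \<comment> \<open>The first term charges level \<open>c\<close> to the outcomes already stopped,
    the second keeps the current value on the rest. Their sum never exceeds the initial
    mass.\<close>
  have key: "c * emeasure M (A T) + (\<integral>\<^sup>+\<omega>. V T \<omega> * indicator (space M - A T) \<omega> \<partial>M)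
      \<le> (\<integral>\<^sup>+\<omega>. V 0 \<omega> \<partial>M)" for T
  proof (induction T)
    case 0
    have "c * emeasure M (A 0) + (\<integral>\<^sup>+\<omega>. V 0 \<omega> * indicator (space M - A 0) \<omega> \<partial>M)
      = (\<integral>\<^sup>+\<omega>. c * indicator (A 0) \<omega> + V 0 \<omega> * indicator (space M - A 0) \<omega> \<partial>M)"
      by (subst nn_integral_add) (auto simp: nn_integral_cmult_indicator)
    also have "\<dots> \<le> (\<integral>\<^sup>+\<omega>. V 0 \<omega> \<partial>M)"
      by (intro nn_integral_mono) (auto simp: A_def indicator_def)
    finally show ?case .
  next
    case (Suc T)
    let ?B = "space M - A T" and ?C = "A (Suc T) - A T"
    have AS: "A (Suc T) = A T \<union> ?C" by (auto simp: A_def le_Suc_eq)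
    have "c * emeasure M (A (Suc T)) + (\<integral>\<^sup>+\<omega>. V (Suc T) \<omega> * indicator (space M - A (Suc T)) \<omega> \<partial>M)
      = c * emeasure M (A T) + (c * emeasure M ?C
          + (\<integral>\<^sup>+\<omega>. V (Suc T) \<omega> * indicator (space M - A (Suc T)) \<omega> \<partial>M))"
      by (subst AS, subst plus_emeasure[symmetric]) (auto simp: distrib_left ac_simps)
    also have "c * emeasure M ?C + (\<integral>\<^sup>+\<omega>. V (Suc T) \<omega> * indicator (space M - A (Suc T)) \<omega> \<partial>M)
       = (\<integral>\<^sup>+\<omega>. c * indicator ?C \<omega> + V (Suc T) \<omega> * indicator (space M - A (Suc T)) \<omega> \<partial>M)"
      by (subst nn_integral_add) (auto simp: nn_integral_cmult_indicator)
    \<comment> \<open>On \<open>?C\<close> the level is reached for the first time at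
      \<open>Suc T\<close>, so there \<open>c\<close> is at most \<open>V (Suc T)\<close>. Together
      with the complement of \<open>A (Suc T)\<close>, \<open>?C\<close> partitions
      \<open>?B\<close>.\<close>
    also have "\<dots> \<le> (\<integral>\<^sup>+\<omega>. V (Suc T) \<omega> * indicator ?B \<omega> \<partial>M)"
      by (intro nn_integral_mono) (auto simp: A_def indicator_def le_Suc_eq)
    also have "\<dots> \<le> (\<integral>\<^sup>+\<omega>. V T \<omega> * indicator ?B \<omega> \<partial>M)"
      using A_F[of T] sp[of T] by (intro super) (metis sets.compl_sets)
    also note Suc.IH
    finally show ?case by (simp add: add_left_mono)
  qed
  \<comment> \<open>Continuity from below along the increasing \<open>A T\<close> turns the
    finite-horizon bounds into one for all times. The nonnegative second term of \<open>key\<close>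
    is then dropped.\<close>
  have "{\<omega> \<in> space M. \<exists>t. c \<le> V t \<omega>} = (\<Union>T. A T)" by (auto simp: A_def)
  moreover have "incseq A" by (rule incseq_SucI) (auto simp: A_def intro: le_SucI)
  ultimately have "c * emeasure M {\<omega> \<in> space M. \<exists>t. c \<le> V t \<omega>} = (SUP T. c * emeasure M (A T))"
    by (simp add: SUP_emeasure_incseq[symmetric] SUP_mult_left_ennreal image_subset_iff)
  also have "\<dots> \<le> (\<integral>\<^sup>+\<omega>. V 0 \<omega> \<partial>M)"
    using key by (intro SUP_least) (meson le_iff_add order_trans)
  finally show ?thesis .
qed

text \<open>The exceptional null sets of the hypothesis depend on \<open>c\<close>, so a random parameter is
  approximated by simple functions, for which only finitely many of them matter, and Fatou's
  lemma is applied.\<close>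

lemma (in sigma_finite_subalgebra) nn_integral_random_parameter_le:
  fixes g :: "real \<Rightarrow> 'a \<Rightarrow> real"
  assumes g [measurable]: "\<And>c. g c \<in> borel_measurable M"
    and g0: "\<And>c \<omega>. 0 \<le> g c \<omega>"
    and cont: "\<And>c \<omega>. isCont (\<lambda>c. g c \<omega>) c"
    and le1: "\<And>c. AE \<omega> in M. nn_cond_exp M F (\<lambda>\<omega>. ennreal (g c \<omega>)) \<omega> \<le> 1"
    and w [measurable]: "w \<in> borel_measurable F" and w0: "\<And>\<omega>. 0 \<le> w \<omega>"
    and L: "L \<in> borel_measurable F"
  shows "(\<integral>\<^sup>+\<omega>. ennreal (w \<omega> * g (L \<omega>) \<omega>) \<partial>M) \<le> (\<integral>\<^sup>+\<omega>. ennreal (w \<omega>) \<partial>M)"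
proof -
  have sp: "space F = space M" using subalg by (simp add: subalgebra_def)
  have [measurable]: "w \<in> borel_measurable M" using measurable_from_subalg[OF subalg w] .
  obtain s :: "nat \<Rightarrow> 'a \<Rightarrow> real" where s: "\<And>i. simple_function F (s i)"
    and lim: "\<And>\<omega>. \<omega> \<in> space M \<Longrightarrow> (\<lambda>i. s i \<omega>) \<longlonglongrightarrow> L \<omega>"
    using borel_measurable_implies_sequence_metric[OF L, of 0] sp by metis
  have step: "(\<lambda>\<omega>. ennreal (w \<omega> * g (u \<omega>) \<omega>)) \<in> borel_measurable M \<and>
     (\<integral>\<^sup>+\<omega>. ennreal (w \<omega> * g (u \<omega>) \<omega>) \<partial>M) \<le> (\<integral>\<^sup>+\<omega>. ennreal (w \<omega>) \<partial>M)"
    if u: "simple_function F u" for u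
  proof -
    define U where "U v = u -` {v} \<inter> space M" for v
    have fin: "finite (u ` space M)" and U_F [measurable]: "U v \<in> sets F" for v
      using u sp simple_functionD(2)[OF u] unfolding simple_function_def U_def by auto
    have [measurable]: "U v \<in> sets M" for v using U_F subalg by (auto simp: subalgebra_def)
    \<comment> \<open>The level sets \<open>U v\<close> partition the space, so exactly one summand
      survives at each point. In each summand the parameter is the constant \<open>v\<close>, to
      which \<open>le1\<close> applies.\<close>
    have split: "ennreal (a (u \<omega>)) = (\<Sum>v\<in>u ` space M. indicator (U v) \<omega> * ennreal (a v))"
      if "\<omega> \<in> space M" for \<omega> and a :: "real \<Rightarrow> real"
    proof -
      have "(\<Sum>v\<in>u ` space M. indicator (U v) \<omega> * ennreal (a v))
          = (\<Sum>v\<in>u ` space M. if v = u \<omega> then ennreal (a v) else 0)"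
        using that by (intro sum.cong) (auto simp: U_def indicator_def)
      also have "\<dots> = ennreal (a (u \<omega>))" using that fin by simp
      finally show ?thesis by simp
    qed
    have eq: "ennreal (w \<omega> * g (u \<omega>) \<omega>)
        = (\<Sum>v\<in>u ` space M. (indicator (U v) \<omega> * ennreal (w \<omega>)) * ennreal (g v \<omega>))"
      if "\<omega> \<in> space M" for \<omega>
      using split[OF that, of "\<lambda>v. w \<omega> * g v \<omega>"] w0 g0 by (simp add: ennreal_mult ac_simps)
    have "(\<integral>\<^sup>+\<omega>. ennreal (w \<omega> * g (u \<omega>) \<omega>) \<partial>M)
        = (\<integral>\<^sup>+\<omega>. (\<Sum>v\<in>u ` space M. (indicator (U v) \<omega> * ennreal (w \<omega>)) * ennreal (g v \<omega>)) \<partial>M)"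
      using eq by (rule nn_integral_cong)
    also have "\<dots> = (\<Sum>v\<in>u ` space M.
        \<integral>\<^sup>+\<omega>. (indicator (U v) \<omega> * ennreal (w \<omega>)) * ennreal (g v \<omega>) \<partial>M)"
      by (rule nn_integral_sum) measurable
    also have "\<dots> = (\<Sum>v\<in>u ` space M. \<integral>\<^sup>+\<omega>. (indicator (U v) \<omega> * ennreal (w \<omega>))
        * nn_cond_exp M F (\<lambda>\<omega>. ennreal (g v \<omega>)) \<omega> \<partial>M)"
      by (intro sum.cong refl nn_cond_exp_intg[symmetric]) measurable
    also have "\<dots> \<le> (\<Sum>v\<in>u ` space M. \<integral>\<^sup>+\<omega>. indicator (U v) \<omega> * ennreal (w \<omega>) \<partial>M)"
    proof (intro sum_mono nn_integral_mono_AE)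
      fix v
      show "AE \<omega> in M. (indicator (U v) \<omega> * ennreal (w \<omega>))
          * nn_cond_exp M F (\<lambda>\<omega>. ennreal (g v \<omega>)) \<omega> \<le> indicator (U v) \<omega> * ennreal (w \<omega>)"
        using le1[of v] by eventually_elim (metis mult.right_neutral mult_left_mono zero_le)
    qed
    also have "\<dots> = (\<integral>\<^sup>+\<omega>. (\<Sum>v\<in>u ` space M. indicator (U v) \<omega> * ennreal (w \<omega>)) \<partial>M)"
      by (rule nn_integral_sum[symmetric]) measurable
    \<comment> \<open>Used with an \<open>a\<close> that is constant in \<open>v\<close>,
      \<open>split\<close> says that the indicators sum to one.\<close>
    also have "\<dots> = (\<integral>\<^sup>+\<omega>. ennreal (w \<omega>) \<partial>M)"
      by (intro nn_integral_cong) (simp add: split[where a = "\<lambda>_. w \<omega>" for \<omega>, symmetric])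
    finally have "(\<integral>\<^sup>+\<omega>. ennreal (w \<omega> * g (u \<omega>) \<omega>) \<partial>M) \<le> (\<integral>\<^sup>+\<omega>. ennreal (w \<omega>) \<partial>M)" .
    moreover have "(\<lambda>\<omega>. ennreal (w \<omega> * g (u \<omega>) \<omega>)) \<in> borel_measurable M"
      by (subst measurable_cong[OF eq]) measurable
    ultimately show ?thesis by simp
  qed
  have "(\<integral>\<^sup>+\<omega>. ennreal (w \<omega> * g (L \<omega>) \<omega>) \<partial>M)
      = (\<integral>\<^sup>+\<omega>. liminf (\<lambda>i. ennreal (w \<omega> * g (s i \<omega>) \<omega>)) \<partial>M)"
  proof (intro nn_integral_cong)
    fix \<omega> assume "\<omega> \<in> space M"
    then have "(\<lambda>i. ennreal (w \<omega> * g (s i \<omega>) \<omega>)) \<longlonglongrightarrow> ennreal (w \<omega> * g (L \<omega>) \<omega>)"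
      by (intro tendsto_ennrealI tendsto_intros isCont_tendsto_compose[OF cont] lim)
    then show "ennreal (w \<omega> * g (L \<omega>) \<omega>) = liminf (\<lambda>i. ennreal (w \<omega> * g (s i \<omega>) \<omega>))"
      by (simp add: lim_imp_Liminf)
  qed
  also have "\<dots> \<le> liminf (\<lambda>i. \<integral>\<^sup>+\<omega>. ennreal (w \<omega> * g (s i \<omega>) \<omega>) \<partial>M)"
    using step[OF s] by (intro nn_integral_liminf) auto
  also have "\<dots> \<le> (\<integral>\<^sup>+\<omega>. ennreal (w \<omega>) \<partial>M)"
    using step[OF s] by (intro Liminf_le) (auto intro: always_eventually)
  finally show ?thesis .
qed

subsection \<open>Gaussian mixtures\<close>

text \<open>Lebesgue measure on a Euclidean space is the image of the product of one-dimensional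
  Lebesgue measures under the coordinate map \<open>?T\<close>, so integrals of coordinatewise
  products factor.\<close>

lemma has_bochner_integral_lborel_prod:
  fixes f :: "'a::euclidean_space \<Rightarrow> real \<Rightarrow> real"
  assumes "\<And>b. b \<in> Basis \<Longrightarrow> has_bochner_integral lborel (f b) (I b)"
  shows "has_bochner_integral lborel (\<lambda>x. \<Prod>b\<in>Basis. f b (x \<bullet> b)) (\<Prod>b\<in>Basis. I b)"
proof -
  let ?T = "\<lambda>x::'a \<Rightarrow> real. \<Sum>b\<in>Basis. x b *\<^sub>R b"
  interpret product_sigma_finite "\<lambda>_::'a. lborel :: real measure" ..
  have int: "\<And>b. b \<in> Basis \<Longrightarrow> integrable lborel (f b)"
    and I: "\<And>b. b \<in> Basis \<Longrightarrow> integral\<^sup>L lborel (f b) = I b"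
    using assms by (auto simp: has_bochner_integral_iff)
  have [measurable]: "\<And>b. b \<in> Basis \<Longrightarrow> f b \<in> borel_measurable borel"
    using int by (force dest: borel_measurable_integrable)
  have "has_bochner_integral (\<Pi>\<^sub>M b\<in>Basis. lborel) (\<lambda>x. \<Prod>b\<in>Basis. f b (x b)) (\<Prod>b\<in>Basis. I b)"
    using product_integrable_prod[of Basis f] product_integral_prod[of Basis f] int I
    by (simp add: has_bochner_integral_iff)
  moreover have "(\<Prod>b\<in>Basis. f b (?T x \<bullet> b)) = (\<Prod>b\<in>Basis. f b (x b))" for x
    by (intro prod.cong refl) (simp add: inner_sum_left inner_Basis if_distrib cong: if_cong)
  moreover have "?T \<in> (\<Pi>\<^sub>M b\<in>Basis. lborel) \<rightarrow>\<^sub>M borel" by measurable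
  ultimately show ?thesis
    unfolding lborel_eq[where 'a='a]
    by (simp add: has_bochner_integral_iff integrable_distr_eq integral_distr)
qed

text \<open>The density of the centred Gaussian with covariance \<open>\<sigma>\<^sup>2\<close>
  times the identity, written as a product over coordinates so that moments factor.\<close>

definition gauss_density :: "real \<Rightarrow> 'a::euclidean_space \<Rightarrow> real" where
  "gauss_density \<sigma> x = (\<Prod>b\<in>Basis. normal_density 0 \<sigma> (x \<bullet> b))"


lemma gauss_density_nonneg: "0 \<le> gauss_density \<sigma> x"
  by (simp add: gauss_density_def prod_nonneg)

lemma borel_measurable_gauss_density [measurable]: "gauss_density \<sigma> \<in> borel_measurable borel"
  unfolding gauss_density_def by measurable

text \<open>Factorization reduces every mixed moment to one-dimensional normal moments. Total
  degrees 0, 1 and 2 give the normalization, the mean and the covariance.\<close>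

lemma has_bochner_integral_gauss_monomial:
  fixes k :: "'a::euclidean_space \<Rightarrow> nat"
  assumes "0 < \<sigma>"
  shows "has_bochner_integral lborel (\<lambda>x. gauss_density \<sigma> x * (\<Prod>b\<in>Basis. (x \<bullet> b) ^ k b))
    (\<Prod>b\<in>Basis. \<integral>y. normal_density 0 \<sigma> y * y ^ k b \<partial>lborel)"
  unfolding gauss_density_def prod.distrib[symmetric]
  using integrable_normal_moment[OF assms, of 0]
  by (intro has_bochner_integral_lborel_prod has_bochner_integral_integrable) simp

lemma has_bochner_integral_gauss_density:
  assumes "0 < \<sigma>"
  shows "has_bochner_integral lborel (gauss_density \<sigma> :: 'a::euclidean_space \<Rightarrow> real) 1"
  using has_bochner_integral_gauss_monomial[OF assms, of "\<lambda>_. 0"] assms by simp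

lemma has_bochner_integral_gauss_first_moment:
  assumes "0 < \<sigma>" "b \<in> Basis"
  shows "has_bochner_integral lborel (\<lambda>x::'a::euclidean_space. gauss_density \<sigma> x * (x \<bullet> b)) 0"
proof -
  let ?k = "\<lambda>d. if d = b then 1 else 0 :: nat"
  have e1: "(\<Prod>d\<in>Basis. (x \<bullet> d) ^ ?k d) = x \<bullet> b" for x :: 'a
    using assms(2) by (simp add: if_distrib cong: if_cong)
  have e2: "(\<Prod>d\<in>Basis. \<integral>y. normal_density 0 \<sigma> y * y ^ ?k d \<partial>lborel) = 0"
    using assms integral_normal_moment_nz_1[OF assms(1), of 0] by (intro prod_zero) auto
  show ?thesis
    using has_bochner_integral_gauss_monomial[OF assms(1), of ?k] unfolding e1 e2 .
qed

lemma has_bochner_integral_gauss_second_moment: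
  assumes "0 < \<sigma>" "b \<in> Basis" "c \<in> Basis"
  shows "has_bochner_integral lborel
    (\<lambda>x::'a::euclidean_space. gauss_density \<sigma> x * ((x \<bullet> b) * (x \<bullet> c))) (if b = c then \<sigma>\<^sup>2 else 0)"
proof -
  \<comment> \<open>The exponents add up, so one vector covers both cases: degree 2 in one
    coordinate if \<open>b = c\<close>, degree 1 in two coordinates otherwise.\<close>
  let ?k = "\<lambda>d. (if d = b then 1 else 0) + (if d = c then 1 else 0) :: nat"
  let ?m = "\<lambda>n. \<integral>y. normal_density 0 \<sigma> y * y ^ n \<partial>lborel"
  have e1: "(\<Prod>d\<in>Basis. (x \<bullet> d) ^ ?k d) = (x \<bullet> b) * (x \<bullet> c)" for x :: 'a
  proof -
    have "(\<Prod>d\<in>Basis. (x \<bullet> d) ^ ?k d)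
        = (\<Prod>d\<in>Basis. (if d = b then x \<bullet> d else 1) * (if d = c then x \<bullet> d else 1))"
      by (intro prod.cong) auto
    then show ?thesis using assms(2,3) by (simp add: prod.distrib)
  qed
  have e2: "(\<Prod>d\<in>Basis. ?m (?k d)) = (if b = c then \<sigma>\<^sup>2 else 0)"
  proof (cases "b = c")
    case True
    have "?m 2 = \<sigma>\<^sup>2"
      using integral_normal_moment_even[OF assms(1), of 0 1] by (simp add: fact_numeral)
    moreover have "(\<Prod>d\<in>Basis. ?m (?k d)) = (\<Prod>d\<in>Basis. if d = b then ?m 2 else 1)"
      using True assms(1) by (intro prod.cong) (auto simp: numeral_2_eq_2)
    ultimately show ?thesis using True assms by simp
  next
    case False
    then show ?thesis
      using assms integral_normal_moment_nz_1[OF assms(1), of 0]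
      by (intro trans[OF prod_zero[OF finite_Basis bexI[of _ b]]]) auto
  qed
  show ?thesis
    using has_bochner_integral_gauss_monomial[OF assms(1), of ?k] unfolding e1 e2 .
qed

text \<open>The linear term has mean zero, and since the covariance is a multiple of the identity
  the quadratic term only sees the diagonal of \<open>f\<close>. The sum over \<open>Basis\<close>
  is the trace of \<open>f\<close>, the origin of the trace term in the final bound.\<close>

lemma has_bochner_integral_gauss_quadratic:
  fixes f :: "'a::euclidean_space \<Rightarrow> 'a"
  assumes \<sigma>: "0 < \<sigma>" and f: "linear f"
  shows "has_bochner_integral lborel (\<lambda>x. gauss_density \<sigma> x * (a + s \<bullet> x - x \<bullet> f x))
    (a - \<sigma>\<^sup>2 * (\<Sum>b\<in>Basis. b \<bullet> f b))"
proof -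
  have "has_bochner_integral lborel
      (\<lambda>x. gauss_density \<sigma> x * a + (\<Sum>b\<in>Basis. (s \<bullet> b) * (gauss_density \<sigma> x * (x \<bullet> b)))
        - (\<Sum>b\<in>Basis. \<Sum>c\<in>Basis. (b \<bullet> f c) * (gauss_density \<sigma> x * ((x \<bullet> b) * (x \<bullet> c)))))
      (1 * a + (\<Sum>b\<in>Basis. (s \<bullet> b) * 0)
        - (\<Sum>b\<in>Basis. \<Sum>c\<in>Basis. (b \<bullet> f c) * (if b = c then \<sigma>\<^sup>2 else 0)))"
    by (intro has_bochner_integral_diff has_bochner_integral_add has_bochner_integral_sum
        has_bochner_integral_mult_left has_bochner_integral_mult_right
        has_bochner_integral_gauss_density has_bochner_integral_gauss_first_moment
        has_bochner_integral_gauss_second_moment \<sigma>)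
  moreover have "x \<bullet> f x = (\<Sum>b\<in>Basis. \<Sum>c\<in>Basis. (b \<bullet> f c) * ((x \<bullet> b) * (x \<bullet> c)))" for x
  proof -
    have "f x = (\<Sum>c\<in>Basis. (x \<bullet> c) *\<^sub>R f c)"
      using linear_sum[OF f, of "\<lambda>c. (x \<bullet> c) *\<^sub>R c" Basis]
      by (simp add: linear_scale[OF f] euclidean_representation)
    then have "x \<bullet> f x = (\<Sum>c\<in>Basis. (x \<bullet> c) * (x \<bullet> f c))"
      by (simp add: inner_sum_right)
    also have "\<dots> = (\<Sum>c\<in>Basis. \<Sum>b\<in>Basis. (b \<bullet> f c) * ((x \<bullet> b) * (x \<bullet> c)))"
      by (subst euclidean_inner) (simp add: sum_distrib_left inner_commute ac_simps)
    finally show ?thesis by (subst sum.swap)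
  qed
  then have "gauss_density \<sigma> x * (a + s \<bullet> x - x \<bullet> f x) =
      gauss_density \<sigma> x * a + (\<Sum>b\<in>Basis. (s \<bullet> b) * (gauss_density \<sigma> x * (x \<bullet> b)))
        - (\<Sum>b\<in>Basis. \<Sum>c\<in>Basis. (b \<bullet> f c) * (gauss_density \<sigma> x * ((x \<bullet> b) * (x \<bullet> c))))" for x
    by (simp add: euclidean_inner[of s x] algebra_simps sum_distrib_left)
  moreover have "(\<Sum>b\<in>Basis. \<Sum>c\<in>Basis. (b \<bullet> f c) * (if b = c then \<sigma>\<^sup>2 else 0))
      = \<sigma>\<^sup>2 * (\<Sum>b\<in>Basis. b \<bullet> f b)"
    by (simp add: if_distrib sum_distrib_left mult.commute cong: if_cong)
  ultimately show ?thesis by simp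
qed

text \<open>Expanding the square in each coordinate gives the density ratio of prior to posterior,
  with the posterior recentred at the origin. The mean of its logarithm is minus the
  divergence.\<close>

lemma gauss_density_shift:
  assumes "0 < \<sigma>"
  shows "gauss_density \<sigma> (\<nu> + x)
    = gauss_density \<sigma> x * exp (- (\<nu> \<bullet> x) / \<sigma>\<^sup>2 - (\<nu> \<bullet> \<nu>) / (2 * \<sigma>\<^sup>2))"
proof -
  have "normal_density 0 \<sigma> (u + v) = normal_density 0 \<sigma> v * exp (- (u * v) / \<sigma>\<^sup>2 - (u * u) / (2 * \<sigma>\<^sup>2))"
    for u v
    using assms unfolding normal_density_def
    by (simp add: exp_add[symmetric] field_simps power2_eq_square)
  then have "gauss_density \<sigma> (\<nu> + x) = gauss_density \<sigma> x
      * exp (\<Sum>b\<in>Basis. - ((\<nu> \<bullet> b) * (x \<bullet> b)) / \<sigma>\<^sup>2 - ((\<nu> \<bullet> b) * (\<nu> \<bullet> b)) / (2 * \<sigma>\<^sup>2))"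
    by (simp add: gauss_density_def inner_add_left prod.distrib exp_sum)
  then show ?thesis
    unfolding euclidean_inner[of \<nu> x] euclidean_inner[of \<nu> \<nu>]
    by (simp only: sum_subtractf sum_negf[symmetric] sum_divide_distrib)
qed

text \<open>The Donsker--Varadhan lower bound with the shifted Gaussian as posterior: after translating
  by \<open>\<nu>\<close>, Jensen's inequality (in the tangent-line form \<open>exp h \<ge> exp m * (1 + h - m)\<close>) only needs
  the first two moments, and \<open>(\<nu> \<bullet> \<nu>) / (2 * \<sigma>\<^sup>2)\<close> is the Kullback--Leibler divergence.\<close>

lemma gauss_mixture_lower_bound:
  fixes f :: "'a::euclidean_space \<Rightarrow> 'a"
  assumes \<sigma>: "0 < \<sigma>" and f: "linear f"
  shows "ennreal (exp (\<nu> \<bullet> s - \<nu> \<bullet> f \<nu> - \<sigma>\<^sup>2 * (\<Sum>b\<in>Basis. b \<bullet> f b) - (\<nu> \<bullet> \<nu>) / (2 * \<sigma>\<^sup>2)))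
    \<le> (\<integral>\<^sup>+x. ennreal (exp (x \<bullet> s - x \<bullet> f x)) * ennreal (gauss_density \<sigma> x) \<partial>lborel)"
proof -
  \<comment> \<open>\<open>a\<close> and \<open>r\<close> collect the constant and linear parts of
    the exponent after translation by \<open>\<nu>\<close>, including the logarithm of the density
    ratio. The term \<open>adjoint f \<nu>\<close> comes from moving \<open>f\<close> off
    \<open>x\<close> in \<open>\<nu> \<bullet> f x\<close>. \<open>m\<close> is the Gaussian mean of
    \<open>h\<close>.\<close>
  define a where "a = \<nu> \<bullet> s - \<nu> \<bullet> f \<nu> - (\<nu> \<bullet> \<nu>) / (2 * \<sigma>\<^sup>2)"
  define r where "r = s - f \<nu> - adjoint f \<nu> - \<nu> /\<^sub>R \<sigma>\<^sup>2"
  define h where "h x = a + r \<bullet> x - x \<bullet> f x" for x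
  define m where "m = a - \<sigma>\<^sup>2 * (\<Sum>b\<in>Basis. b \<bullet> f b)"
  have [measurable]: "f \<in> borel_measurable borel"
    using f by (simp add: borel_measurable_continuous_onI linear_continuous_on linear_conv_bounded_linear)
  \<comment> \<open>The integrand is the tangent of the exponential at \<open>m\<close>, evaluated
    at \<open>h x\<close>. The choice of \<open>m\<close> makes \<open>1 + a - m\<close> minus the
    trace term equal to 1, so the integral is exactly \<open>exp m\<close>.\<close>
  have "has_bochner_integral lborel (\<lambda>x. exp m * (gauss_density \<sigma> x * ((1 + a - m) + r \<bullet> x - x \<bullet> f x)))
      (exp m * ((1 + a - m) - \<sigma>\<^sup>2 * (\<Sum>b\<in>Basis. b \<bullet> f b)))"
    by (intro has_bochner_integral_mult_right has_bochner_integral_gauss_quadratic \<sigma> f)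
  then have H: "has_bochner_integral lborel (\<lambda>x. exp m * (gauss_density \<sigma> x * (1 + h x - m))) (exp m)"
    by (simp add: h_def m_def algebra_simps)
  have shift: "ennreal (exp ((\<nu> + x) \<bullet> s - (\<nu> + x) \<bullet> f (\<nu> + x))) * ennreal (gauss_density \<sigma> (\<nu> + x))
      = ennreal (exp (h x) * gauss_density \<sigma> x)" for x
  proof -
    let ?q = "(\<nu> + x) \<bullet> s - (\<nu> + x) \<bullet> f (\<nu> + x)"
    let ?d = "- (\<nu> \<bullet> x) / \<sigma>\<^sup>2 - (\<nu> \<bullet> \<nu>) / (2 * \<sigma>\<^sup>2)"
    have "r \<bullet> x = x \<bullet> s - x \<bullet> f \<nu> - \<nu> \<bullet> f x - (\<nu> \<bullet> x) / \<sigma>\<^sup>2"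
      using adjoint_works[OF f, of x \<nu>] unfolding r_def
      by (simp add: inner_diff_left inner_diff_right inner_commute[of _ x] inner_commute[of "f x"] divide_inverse mult.commute)
    then have "h x = ?q + ?d"
      unfolding h_def a_def linear_add[OF f] inner_add_left inner_add_right by linarith
    then have "exp (h x) = exp ?q * exp ?d" by (simp only: exp_add)
    then have "exp ?q * gauss_density \<sigma> (\<nu> + x) = exp (h x) * gauss_density \<sigma> x"
      unfolding gauss_density_shift[OF \<sigma>] by (simp only: ac_simps)
    then show ?thesis
      by (metis ennreal_mult' exp_ge_zero)
  qed
  have "ennreal (exp m) = ennreal (\<integral>x. exp m * (gauss_density \<sigma> x * (1 + h x - m)) \<partial>lborel)"
    using H by (simp add: has_bochner_integral_iff)
  \<comment> \<open>The tangent line may be negative, so it is truncated at 0 before passing to the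
    nonnegative integral.\<close>
  also have "\<dots> \<le> ennreal (\<integral>x. max 0 (exp m * (gauss_density \<sigma> x * (1 + h x - m))) \<partial>lborel)"
    using H by (intro ennreal_leI integral_mono) (auto simp: has_bochner_integral_iff)
  also have "\<dots> = (\<integral>\<^sup>+x. ennreal (max 0 (exp m * (gauss_density \<sigma> x * (1 + h x - m)))) \<partial>lborel)"
    using H by (intro nn_integral_eq_integral[symmetric]) (auto simp: has_bochner_integral_iff)
  also have "\<dots> \<le> (\<integral>\<^sup>+x. ennreal (exp (h x) * gauss_density \<sigma> x) \<partial>lborel)"
  proof (intro nn_integral_mono ennreal_leI max.boundedI)
    fix x
    have "exp m * (1 + (h x - m)) \<le> exp m * exp (h x - m)"
      by (intro mult_left_mono exp_ge_add_one_self) simp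
    then have "exp m * (1 + h x - m) \<le> exp (h x)"
      by (simp add: exp_add[symmetric] add_diff_eq)
    from mult_right_mono[OF this gauss_density_nonneg[of \<sigma> x]]
    show "exp m * (gauss_density \<sigma> x * (1 + h x - m)) \<le> exp (h x) * gauss_density \<sigma> x"
      by (simp add: ac_simps)
  qed (simp add: gauss_density_nonneg)
  also have "\<dots> = (\<integral>\<^sup>+x. ennreal (exp ((\<nu> + x) \<bullet> s - (\<nu> + x) \<bullet> f (\<nu> + x)))
      * ennreal (gauss_density \<sigma> (\<nu> + x)) \<partial>lborel)"
    by (simp add: shift)
  \<comment> \<open>The translation by \<open>\<nu>\<close> is undone by the translation invariance
    of Lebesgue measure.\<close>
  also have "\<dots> = (\<integral>\<^sup>+x. ennreal (exp (x \<bullet> s - x \<bullet> f x)) * ennreal (gauss_density \<sigma> x)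
      \<partial>distr lborel borel ((+) \<nu>))"
    by (rule nn_integral_distr[symmetric]) measurable
  finally show ?thesis
    by (simp add: lborel_distr_plus m_def a_def algebra_simps)
qed

subsection \<open>Matrices\<close>

lemma sum_Basis_inner_matrix:
  fixes A :: "real ^ 'n ^ 'n"
  shows "(\<Sum>b\<in>Basis. b \<bullet> (A *v b)) = trace A"
proof -
  have Basis: "(Basis :: (real ^ 'n) set) = range (\<lambda>i. axis i 1)"
    by (auto simp: Basis_vec_def)
  have "(\<Sum>b\<in>Basis. b \<bullet> (A *v b)) = (\<Sum>i\<in>UNIV. axis i 1 \<bullet> (A *v axis i 1))"
    unfolding Basis by (subst sum.reindex) (auto simp: inj_on_def axis_eq_axis)
  then show ?thesis
    by (simp add: trace_def inner_axis' matrix_vector_mul_component inner_axis)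
qed

text \<open>The operator norm is convex, and a finite convex function on a finite-dimensional space
  is continuous.\<close>

lemma borel_measurable_op_norm [measurable]: "op_norm \<in> borel_measurable borel"
proof (rule borel_measurable_continuous_onI)
  have "convex_on UNIV (op_norm :: real ^ 'n ^ 'n \<Rightarrow> real)"
  proof (rule convex_onI)
    fix t :: real and A B :: "real ^ 'n ^ 'n" assume "0 < t" "t < 1"
    then show "op_norm ((1 - t) *\<^sub>R A + t *\<^sub>R B) \<le> (1 - t) * op_norm A + t * op_norm B"
      unfolding op_norm_def matrix_vector_mult_add_rdistrib scaleR_matrix_vector_assoc[symmetric]
      using onorm_triangle[of "\<lambda>v. (1 - t) *\<^sub>R (A *v v)" "\<lambda>v. t *\<^sub>R (B *v v)"]
      by (simp add: onorm_scaleR bounded_linear_const_scaleR)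
  qed simp
  then show "continuous_on UNIV (op_norm :: real ^ 'n ^ 'n \<Rightarrow> real)"
    by (intro convex_on_continuous) auto
qed

lemma inner_matrix_le_op_norm: "v \<bullet> (A *v v) \<le> op_norm A * (v \<bullet> v)"
proof -
  have "v \<bullet> (A *v v) \<le> norm v * norm (A *v v)" by (rule norm_cauchy_schwarz)
  also have "\<dots> \<le> norm v * (op_norm A * norm v)"
    unfolding op_norm_def by (intro mult_left_mono onorm matrix_vector_mul_bounded_linear) simp
  finally show ?thesis by (simp add: power2_norm_eq_inner[symmetric] power2_eq_square ac_simps)
qed

lemma borel_measurable_trace [measurable]: "trace \<in> borel_measurable (borel :: (real ^ 'n ^ 'n) measure)"
  unfolding trace_def by (intro borel_measurable_continuous_onI continuous_intros)

lemma borel_measurable_quadratic_form [measurable (raw)]: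
  fixes f :: "'a \<Rightarrow> real ^ 'n" and A :: "'a \<Rightarrow> real ^ 'n ^ 'n"
  assumes "f \<in> borel_measurable M" "A \<in> borel_measurable M"
  shows "(\<lambda>x. f x \<bullet> (A x *v f x)) \<in> borel_measurable M"
proof (rule borel_measurable_continuous_Pair[OF assms, of "\<lambda>v B. v \<bullet> (B *v v)"])
  show "continuous_on UNIV (\<lambda>x :: (real ^ 'n) \<times> (real ^ 'n ^ 'n). fst x \<bullet> (snd x *v fst x))"
    unfolding matrix_vector_mult_def by (intro continuous_intros continuous_on_vec_lambda)
qed

subsection \<open>The confidence sequence\<close>

theorem theorem2p2:
  fixes M :: "'a measure"
    and X :: "nat \<Rightarrow> 'a \<Rightarrow> real ^ 'n"
    and \<mu> :: "real ^ 'n"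
    and \<Sigma> :: "nat \<Rightarrow> 'a \<Rightarrow> real ^ 'n ^ 'n"
    and l :: "nat \<Rightarrow> 'a \<Rightarrow> real"
    and \<alpha> \<beta> :: real
  assumes "prob_space M"
    and "\<And>t. 1 \<le> t \<Longrightarrow> X t \<in> borel_measurable M"
    and "const_cond_mean M X \<mu>"
    and "cond_sub_gaussian M X \<mu> \<Sigma>"
    and "predictable (obs_filtration M X) l"
    and "\<And>t \<omega>. 1 \<le> t \<Longrightarrow> \<omega> \<in> space M \<Longrightarrow> 0 < l t \<omega>"
    and "0 < \<beta>"
    and "0 < \<alpha>" and "\<alpha> < 1"
  shows "measure M {\<omega> \<in> space M. \<forall>t\<ge>1.
      norm ((\<Sum>i=1..t. l i \<omega> *\<^sub>R X i \<omega>) /\<^sub>R (\<Sum>i=1..t. l i \<omega>) - \<mu>)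
      \<le> ((\<Sum>i=1..t. psi_N (l i \<omega>) * (op_norm (\<Sigma> i \<omega>) + inverse \<beta> * trace (\<Sigma> i \<omega>)))
           + \<beta> / 2 + ln (1 / \<alpha>)) / (\<Sum>i=1..t. l i \<omega>)}
    \<ge> 1 - \<alpha>"
proof -
  interpret prob_space M by fact
  define F where "F = obs_filtration M X"
  define D where "D i \<omega> \<theta> = l i \<omega> * (\<theta> \<bullet> (X i \<omega> - \<mu>)) - psi_N (l i \<omega>) * (\<theta> \<bullet> (\<Sigma> i \<omega> *v \<theta>))"
    for i \<omega> \<theta>
  define Z where "Z t \<omega> \<theta> = exp (\<Sum>i=1..t. D i \<omega> \<theta>)" for t \<omega> \<theta>
  \<comment> \<open>The prior variance is \<open>inverse \<beta>\<close>: it becomes the coefficient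
    of the trace, and the divergence \<open>1 / (2 * \<sigma>\<^sup>2)\<close> for a unit shift
    becomes \<open>\<beta> / 2\<close>.\<close>
  define \<sigma> where "\<sigma> = 1 / sqrt \<beta>"
  have \<sigma>: "0 < \<sigma>" and \<sigma>2: "\<sigma>\<^sup>2 = inverse \<beta>"
    using \<open>0 < \<beta>\<close> by (auto simp: \<sigma>_def power_divide inverse_eq_divide)
  define V where "V t \<omega> = (\<integral>\<^sup>+\<theta>. ennreal (Z t \<omega> \<theta>) * ennreal (gauss_density \<sigma> \<theta>) \<partial>lborel)"
    for t \<omega>

  \<comment> \<open>Measurability of the processes\<close>
  have sub: "subalgebra M (F t)" for t
    unfolding F_def using assms(2) by (rule subalgebra_obs_filtration)
  have mono: "subalgebra (F t) (F s)" if "s \<le> t" for s t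
    unfolding F_def using that by (rule subalgebra_obs_filtration_mono)
  have X_F: "X i \<in> borel_measurable (F t)" if "1 \<le> i" "i \<le> t" for i t
    unfolding F_def using that by (rule measurable_obs_filtration)
  \<comment> \<open>Predictability, shifted by one: the next coefficient is already known at time
    \<open>t\<close>.\<close>
  have l_pred: "l (Suc t) \<in> borel_measurable (F t)" for t
    using assms(5) unfolding predictable_def F_def by (metis diff_Suc_1 le_add1 plus_1_eq_Suc)
  have l_F: "l i \<in> borel_measurable (F t)" if "1 \<le> i" "i \<le> t" for i t
    using measurable_from_subalg[OF mono l_pred, of "i - 1" t] that by simp
  have \<Sigma>_F: "\<Sigma> i \<in> borel_measurable (F t)" if "1 \<le> i" "i \<le> t" for i t
    using measurable_from_subalg[OF mono[OF that(2)], of "\<Sigma> i"] assms(4) that(1)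
    unfolding cond_sub_gaussian_def F_def by blast
  have M_meas [measurable]: "X i \<in> borel_measurable M" "l i \<in> borel_measurable M"
      "\<Sigma> i \<in> borel_measurable M" if "1 \<le> i" for i
    using that X_F[of i i] l_F[of i i] \<Sigma>_F[of i i] measurable_from_subalg[OF sub] by auto
  \<comment> \<open>Stated for an arbitrary \<open>N\<close>, so that it serves both for the
    filtration and for \<open>M\<close>.\<close>
  have D_meas: "(\<lambda>x. D i (fst x) (snd x)) \<in> borel_measurable (N \<Otimes>\<^sub>M lborel)"
    if [measurable]: "X i \<in> borel_measurable N" "l i \<in> borel_measurable N" "\<Sigma> i \<in> borel_measurable N"
    for i N
    unfolding D_def psi_N_def by measurable
  have Z_meas: "(\<lambda>x. Z t (fst x) (snd x)) \<in> borel_measurable (F s \<Otimes>\<^sub>M lborel)" if "t \<le> s" for s t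
    unfolding Z_def using that
    by (intro borel_measurable_exp borel_measurable_sum D_meas X_F l_F \<Sigma>_F measurable_compose[OF _ borel_measurable_exp]) auto
  have Z_meas_M [measurable]: "(\<lambda>x. Z t (fst x) (snd x)) \<in> borel_measurable (M \<Otimes>\<^sub>M lborel)" for t
    unfolding Z_def by (intro measurable_compose[OF _ borel_measurable_exp] borel_measurable_sum D_meas) auto
  have Z_fix: "(\<lambda>\<omega>. Z t \<omega> \<theta>) \<in> borel_measurable (F t)" for t \<theta>
    using measurable_compose[OF measurable_Pair2' Z_meas[OF order_refl], of \<theta>] by simp
  have adapted: "V t \<in> borel_measurable (F t)" for t
  proof -
    note [measurable] = Z_meas[OF order_refl, of t]
    have "(\<lambda>x. ennreal (Z t (fst x) (snd x)) * ennreal (gauss_density \<sigma> (snd x)))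
        \<in> borel_measurable (F t \<Otimes>\<^sub>M lborel)" by measurable
    then show ?thesis
      unfolding V_def by (intro lborel.borel_measurable_nn_integral) (simp add: split_def)
  qed
  \<comment> \<open>The supermartingale property for fixed \<open>\<theta>\<close>. In this
    integrated form it leaves no null set depending on \<open>\<theta>\<close>, which lets it be
    mixed over \<open>\<theta>\<close> afterwards.\<close>
  have increment: "(\<integral>\<^sup>+\<omega>. ennreal (Z (Suc t) \<omega> \<theta>) * indicator B \<omega> \<partial>M)
      \<le> (\<integral>\<^sup>+\<omega>. ennreal (Z t \<omega> \<theta>) * indicator B \<omega> \<partial>M)" if B: "B \<in> sets (F t)" for t B \<theta>
  proof -
    interpret Ft: sigma_finite_subalgebra M "F t"
      using sub[of t] finite_measure_axioms
      by (intro finite_measure_subalgebra_is_sigma_finite)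
        (simp add: finite_measure_subalgebra_def finite_measure_subalgebra_axioms_def)
    define g where "g c \<omega> = exp (c * (\<theta> \<bullet> (X (Suc t) \<omega> - \<mu>))
      - psi_N c * (\<theta> \<bullet> (\<Sigma> (Suc t) \<omega> *v \<theta>)))" for c \<omega>
    note [measurable] = Z_fix[of t \<theta>] B M_meas[of "Suc t", simplified]
    \<comment> \<open>The weight, the indicator of \<open>B\<close> times the current value, and the
      parameter \<open>l (Suc t)\<close> are both measurable at time \<open>t\<close>, so the bound
      for constant parameters carries over to the random one.\<close>
    have "(\<integral>\<^sup>+\<omega>. ennreal (indicator B \<omega> * Z t \<omega> \<theta> * g (l (Suc t) \<omega>) \<omega>) \<partial>M)
        \<le> (\<integral>\<^sup>+\<omega>. ennreal (indicator B \<omega> * Z t \<omega> \<theta>) \<partial>M)"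
    proof (rule Ft.nn_integral_random_parameter_le[where g = g and L = "l (Suc t)"])
      show "g c \<in> borel_measurable M" for c unfolding g_def by measurable
      show "isCont (\<lambda>c. g c \<omega>) c" for c \<omega>
        unfolding g_def psi_N_def by (intro continuous_intros) auto
      show "AE \<omega> in M. nn_cond_exp M (F t) (\<lambda>\<omega>. ennreal (g c \<omega>)) \<omega> \<le> 1" for c
        using spec[OF assms(4)[unfolded cond_sub_gaussian_def], of "Suc t"]
        by (simp add: g_def F_def)
      show "(\<lambda>\<omega>. indicator B \<omega> * Z t \<omega> \<theta>) \<in> borel_measurable (F t)" by measurable
    qed (auto simp: g_def Z_def l_pred)
    moreover have "ennreal (indicator B \<omega> * Z t \<omega> \<theta> * g (l (Suc t) \<omega>) \<omega>)
        = ennreal (Z (Suc t) \<omega> \<theta>) * indicator B \<omega>" for \<omega>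
      by (simp add: Z_def g_def D_def exp_add indicator_def)
    moreover have "ennreal (indicator B \<omega> * Z t \<omega> \<theta>) = ennreal (Z t \<omega> \<theta>) * indicator B \<omega>" for \<omega>
      by (simp add: indicator_def)
    ultimately show ?thesis by simp
  qed

  \<comment> \<open>The mixture is a supermartingale, by exchanging integrals\<close>
  interpret P: pair_sigma_finite M "lborel :: (real ^ 'n) measure" ..
  have swap: "(\<integral>\<^sup>+\<omega>. V t \<omega> * indicator B \<omega> \<partial>M)
      = (\<integral>\<^sup>+\<theta>. (\<integral>\<^sup>+\<omega>. ennreal (Z t \<omega> \<theta>) * indicator B \<omega> \<partial>M) * ennreal (gauss_density \<sigma> \<theta>) \<partial>lborel)"
    if [measurable]: "B \<in> sets M" for t B
  proof -
    have [measurable]: "(\<lambda>\<omega>. Z t \<omega> \<theta>) \<in> borel_measurable M" for \<theta>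
      using measurable_from_subalg[OF sub Z_fix] .
    have [measurable]: "(\<lambda>\<theta>. Z t \<omega> \<theta>) \<in> borel_measurable borel" if "\<omega> \<in> space M" for \<omega>
      using measurable_compose[OF measurable_Pair1'[OF that] Z_meas_M] by simp
    have "(\<integral>\<^sup>+\<omega>. V t \<omega> * indicator B \<omega> \<partial>M) = (\<integral>\<^sup>+\<omega>. \<integral>\<^sup>+\<theta>. ennreal (Z t \<omega> \<theta>)
        * ennreal (gauss_density \<sigma> \<theta>) * indicator B \<omega> \<partial>lborel \<partial>M)"
      unfolding V_def by (intro nn_integral_cong nn_integral_multc[symmetric]) measurable
    also have "\<dots> = (\<integral>\<^sup>+\<theta>. \<integral>\<^sup>+\<omega>. ennreal (Z t \<omega> \<theta>)
        * ennreal (gauss_density \<sigma> \<theta>) * indicator B \<omega> \<partial>M \<partial>lborel)"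
      by (rule P.Fubini'[symmetric]) (simp add: split_def)
    also have "\<dots> = (\<integral>\<^sup>+\<theta>. \<integral>\<^sup>+\<omega>. (ennreal (Z t \<omega> \<theta>) * indicator B \<omega>)
        * ennreal (gauss_density \<sigma> \<theta>) \<partial>M \<partial>lborel)"
      by (simp only: ac_simps)
    also have "\<dots> = (\<integral>\<^sup>+\<theta>. (\<integral>\<^sup>+\<omega>. ennreal (Z t \<omega> \<theta>) * indicator B \<omega> \<partial>M)
        * ennreal (gauss_density \<sigma> \<theta>) \<partial>lborel)"
      by (intro nn_integral_cong nn_integral_multc) measurable
    finally show ?thesis .
  qed
  have super: "(\<integral>\<^sup>+\<omega>. V (Suc t) \<omega> * indicator B \<omega> \<partial>M) \<le> (\<integral>\<^sup>+\<omega>. V t \<omega> * indicator B \<omega> \<partial>M)"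
    if "B \<in> sets (F t)" for t B
  proof -
    have "B \<in> sets M" using that sub[of t] by (auto simp: subalgebra_def)
    then show ?thesis
      unfolding swap[OF \<open>B \<in> sets M\<close>]
      by (intro nn_integral_mono[OF mult_right_mono] increment that) auto
  qed

  \<comment> \<open>Ville's inequality for the mixture\<close>
  have "(\<integral>\<^sup>+\<theta>. ennreal (gauss_density \<sigma> (\<theta> :: real ^ 'n)) \<partial>lborel) = 1"
    using has_bochner_integral_gauss_density[OF \<sigma>, where 'a="real ^ 'n"]
    by (subst nn_integral_eq_integral) (auto simp: has_bochner_integral_iff gauss_density_nonneg)
  then have V0: "V 0 \<omega> = 1" for \<omega> by (simp add: V_def Z_def)
  define Bad where "Bad = {\<omega> \<in> space M. \<exists>t. ennreal (1 / \<alpha>) \<le> V t \<omega>}"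
  have [measurable]: "V t \<in> borel_measurable M" for t
    using measurable_from_subalg[OF sub adapted] .
  have [measurable]: "Bad \<in> sets M" unfolding Bad_def by measurable
  have "ennreal (1 / \<alpha>) * emeasure M Bad \<le> (\<integral>\<^sup>+\<omega>. V 0 \<omega> \<partial>M)"
    unfolding Bad_def by (intro Ville_inequality[where F = F] sub mono adapted super)
  moreover have "ennreal (1 / \<alpha>) * emeasure M Bad = ennreal (1 / \<alpha> * measure M Bad)"
    using \<open>0 < \<alpha>\<close> by (subst ennreal_mult') (auto simp: emeasure_eq_measure)
  moreover have "(\<integral>\<^sup>+\<omega>. V 0 \<omega> \<partial>M) = 1"
    by (simp only: V0 nn_integral_const emeasure_space_1 mult_1)
  ultimately have "1 / \<alpha> * measure M Bad \<le> 1" by simp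
  then have Bad: "measure M Bad \<le> \<alpha>" using \<open>0 < \<alpha>\<close> by (simp add: field_simps)

  \<comment> \<open>The deterministic bound outside the exceptional event\<close>
  define Good where "Good t \<omega> \<longleftrightarrow> norm ((\<Sum>i=1..t. l i \<omega> *\<^sub>R X i \<omega>) /\<^sub>R (\<Sum>i=1..t. l i \<omega>) - \<mu>)
      \<le> ((\<Sum>i=1..t. psi_N (l i \<omega>) * (op_norm (\<Sigma> i \<omega>) + inverse \<beta> * trace (\<Sigma> i \<omega>)))
           + \<beta> / 2 + ln (1 / \<alpha>)) / (\<Sum>i=1..t. l i \<omega>)" for t \<omega>
  have bound: "Good t \<omega>" if \<omega>: "\<omega> \<in> space M" "\<omega> \<notin> Bad" and t: "1 \<le> t" for t \<omega>
  proof -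
    define L where "L = (\<Sum>i=1..t. l i \<omega>)"
    define S where "S = (\<Sum>i=1..t. l i \<omega> *\<^sub>R (X i \<omega> - \<mu>))"
    \<comment> \<open>Collecting the quadratic terms into one linear map gives the exponent of
      \<open>Z\<close> the shape required by \<open>gauss_mixture_lower_bound\<close>.\<close>
    define f where "f \<theta> = (\<Sum>i=1..t. psi_N (l i \<omega>) *\<^sub>R (\<Sigma> i \<omega> *v \<theta>))" for \<theta>
    have L: "0 < L" unfolding L_def using assms(6) \<omega> t by (intro sum_pos) auto
    \<comment> \<open>If \<open>S = 0\<close> there is no direction to follow, and any unit vector
      will do.\<close>
    obtain \<nu> :: "real ^ 'n" where \<nu>: "\<nu> \<bullet> \<nu> = 1" "\<nu> \<bullet> S = norm S"
    proof (cases "S = 0")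
      case True
      then show ?thesis using that[of "axis undefined 1"] by (simp add: inner_axis_axis)
    next
      case False
      then show ?thesis using that[of "S /\<^sub>R norm S"]
        by (simp add: power2_norm_eq_inner[symmetric] power2_eq_square)
    qed
    have f: "linear f" unfolding f_def
      by (intro linear_compose_sum ballI linear_compose_scale_right matrix_vector_mul_linear)
    have Z: "Z t \<omega> \<theta> = exp (\<theta> \<bullet> S - \<theta> \<bullet> f \<theta>)" for \<theta>
      by (simp add: Z_def D_def S_def f_def inner_sum_right sum_subtractf)
    have tr: "(\<Sum>b\<in>Basis. b \<bullet> f b) = (\<Sum>i=1..t. psi_N (l i \<omega>) * trace (\<Sigma> i \<omega>))"
      by (simp add: f_def inner_sum_right sum.swap[of _ Basis] sum_Basis_inner_matrix[symmetric] sum_distrib_left)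
    \<comment> \<open>The direction \<open>\<nu>\<close> depends on the data, so its quadratic forms
      are bounded by operator norms; the weights \<open>psi_N\<close> are nonnegative.\<close>
    have f_le: "\<nu> \<bullet> f \<nu> \<le> (\<Sum>i=1..t. psi_N (l i \<omega>) * op_norm (\<Sigma> i \<omega>))"
      unfolding f_def inner_sum_right
      using inner_matrix_le_op_norm[of \<nu>] \<nu>(1)
      by (intro sum_mono) (auto simp: psi_N_def intro!: mult_left_mono)
    have "ennreal (exp (norm S - \<nu> \<bullet> f \<nu> - inverse \<beta> * (\<Sum>b\<in>Basis. b \<bullet> f b) - \<beta> / 2))
        \<le> V t \<omega>"
    proof -
      have "(\<nu> \<bullet> \<nu>) / (2 * \<sigma>\<^sup>2) = \<beta> / 2" using \<open>0 < \<beta>\<close> by (simp add: \<nu> \<sigma>2 field_simps)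
      then show ?thesis
        using gauss_mixture_lower_bound[OF \<sigma> f, of \<nu> S] by (simp only: V_def Z \<nu>(2) \<sigma>2)
    qed
    moreover have "V t \<omega> < ennreal (1 / \<alpha>)"
      using \<omega> by (auto simp: Bad_def not_le)
    ultimately have "ennreal (exp (norm S - \<nu> \<bullet> f \<nu> - inverse \<beta> * (\<Sum>b\<in>Basis. b \<bullet> f b) - \<beta> / 2))
        < ennreal (1 / \<alpha>)"
      by (rule le_less_trans)
    then have "exp (norm S - \<nu> \<bullet> f \<nu> - inverse \<beta> * (\<Sum>b\<in>Basis. b \<bullet> f b) - \<beta> / 2) < 1 / \<alpha>"
      by (simp add: ennreal_less_iff)
    then have "norm S - \<nu> \<bullet> f \<nu> - inverse \<beta> * (\<Sum>b\<in>Basis. b \<bullet> f b) - \<beta> / 2 < ln (1 / \<alpha>)"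
      using \<open>0 < \<alpha>\<close> by (subst exp_less_cancel_iff[symmetric], subst exp_ln) auto
    with f_le have "norm S \<le> (\<Sum>i=1..t. psi_N (l i \<omega>) * op_norm (\<Sigma> i \<omega>))
        + inverse \<beta> * (\<Sum>i=1..t. psi_N (l i \<omega>) * trace (\<Sigma> i \<omega>)) + \<beta> / 2 + ln (1 / \<alpha>)"
      unfolding tr by linarith
    also have "(\<Sum>i=1..t. psi_N (l i \<omega>) * op_norm (\<Sigma> i \<omega>))
        + inverse \<beta> * (\<Sum>i=1..t. psi_N (l i \<omega>) * trace (\<Sigma> i \<omega>))
        = (\<Sum>i=1..t. psi_N (l i \<omega>) * (op_norm (\<Sigma> i \<omega>) + inverse \<beta> * trace (\<Sigma> i \<omega>)))"
      by (simp add: sum_distrib_left sum.distrib[symmetric] algebra_simps)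
    finally have S_le: "norm S \<le> (\<Sum>i=1..t. psi_N (l i \<omega>) * (op_norm (\<Sigma> i \<omega>) + inverse \<beta> * trace (\<Sigma> i \<omega>)))
        + \<beta> / 2 + ln (1 / \<alpha>)" .
    \<comment> \<open>Centring each \<open>X i \<omega>\<close> subtracts
      \<open>L *\<^sub>R \<mu>\<close> in total, so dividing \<open>S\<close> by \<open>L\<close>
      gives the estimation error.\<close>
    have "S = (\<Sum>i=1..t. l i \<omega> *\<^sub>R X i \<omega>) - L *\<^sub>R \<mu>"
      by (simp add: S_def L_def scaleR_diff_right sum_subtractf scaleR_sum_left)
    then have "(\<Sum>i=1..t. l i \<omega> *\<^sub>R X i \<omega>) /\<^sub>R L - \<mu> = S /\<^sub>R L"
      using L by (simp add: scaleR_diff_right)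
    then have "norm ((\<Sum>i=1..t. l i \<omega> *\<^sub>R X i \<omega>) /\<^sub>R L - \<mu>) = norm S / L"
      using L by (simp add: divide_inverse mult.commute)
    also note divide_right_mono[OF S_le, of L]
    finally show ?thesis using L unfolding Good_def L_def by simp
  qed

  \<comment> \<open>Measurability of the coverage event\<close>
  have [measurable]: "{\<omega> \<in> space M. Good t \<omega>} \<in> sets M" for t
  proof -
    have [measurable]: "(\<lambda>\<omega>. \<Sum>i=1..t. l i \<omega>) \<in> borel_measurable M"
      by (intro borel_measurable_sum M_meas) simp
    have [measurable]: "(\<lambda>\<omega>. \<Sum>i=1..t. l i \<omega> *\<^sub>R X i \<omega>) \<in> borel_measurable M"
      by (intro borel_measurable_sum borel_measurable_scaleR M_meas) simp_all
    have [measurable]: "(\<lambda>\<omega>. \<Sum>i=1..t. psi_N (l i \<omega>) * (op_norm (\<Sigma> i \<omega>) + inverse \<beta> * trace (\<Sigma> i \<omega>)))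
        \<in> borel_measurable M"
      unfolding psi_N_def
      by (intro borel_measurable_sum borel_measurable_times borel_measurable_add
          borel_measurable_divide borel_measurable_power borel_measurable_const M_meas
          measurable_compose[OF M_meas(3) borel_measurable_op_norm]
          measurable_compose[OF M_meas(3) borel_measurable_trace]) simp_all
    show ?thesis
      unfolding Good_def
      by (intro borel_measurable_le borel_measurable_norm borel_measurable_diff
          borel_measurable_scaleR borel_measurable_divide borel_measurable_add) measurable
  qed
  \<comment> \<open>The event is a countable intersection of measurable sets. Without measurability
    its \<open>measure\<close> would be 0 by convention, and monotonicity could not be
    applied.\<close>
  have "{\<omega> \<in> space M. \<forall>t\<ge>1. Good t \<omega>} \<in> sets M" by measurable
  then have "measure M (space M - Bad) \<le> measure M {\<omega> \<in> space M. \<forall>t\<ge>1. Good t \<omega>}"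
    using bound by (intro finite_measure_mono) auto
  then have "1 - \<alpha> \<le> measure M {\<omega> \<in> space M. \<forall>t\<ge>1. Good t \<omega>}"
    using Bad by (simp add: prob_compl)
  then show ?thesis unfolding Good_def .
qed

end
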